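(* Let $\mathbb{B}_H$ be the open unit ball of a complex Hilbert space $H$, let $\omega$ be a normal function, and let $f\in H(\mathbb{B}_H)$. Then: (i) $f\in\mathcal{B}_{\mathcal{R}}(\mathbb{B}_H)_{\omega}$ if and only if $\sup_{z\in\mathbb{B}_H}\omega(z)\|Df(z)\|<\infty$. Moreover, $$\|f\|_{\mathcal{R},\omega}\simeq|f(0)|+\sup_{z\in\mathbb{B}_H}\omega(z)\|Df(z)\|,$$ i.e. there is a constant $C>0$, independent of $f$, such that each of the two sides is at most $C$ times the other. (ii) $f\in\mathcal{B}_{\mathcal{R}}(\mathbb{B}_H)_{\omega,0}$ if and only if $\lim_{\|z\|\to1}\omega(z)\|Df(z)\|=0$.
   Context: A positive continuous function $\omega$ on $[0,1)$ is normal if there are constants $\delta\in[0,1)$ and $0<a<b<\infty$ such that on $[\delta,1)$ the function $\omega(r)/(1-r)^a$ is decreasing and $\omega(r)/(1-r)^b$ is increasing. A normal function is extended to $\mathbb{B}_H$ by $\omega(z)=\omega(\|z\|)$. $H(\mathbb{B}_H)$ is the set of holomorphic functions $\mathbb{B}_H\to\mathbb{C}$. For $f\in H(\mathbb{B}_H)$, $Df(z)$ is the Fréchet derivative of $f$ at $z$, $\|Df(z)\|$ its norm as a linear functional, and $\mathcal{R}f(z)=Df(z)z$. The Bloch-type space $\mathcal{B}_{\mathcal{R}}(\mathbb{B}_H)_{\omega}$ is the set of $f\in H(\mathbb{B}_H)$ with $\sup_{z\in\mathbb{B}_H}\omega(z)|\mathcal{R}f(z)|<\infty$, with norm $\|f\|_{\mathcal{R},\omega}=|f(0)|+\sup_{z\in\mathbb{B}_H}\omega(z)|\mathcal{R}f(z)|$.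 The little Bloch-type space $\mathcal{B}_{\mathcal{R}}(\mathbb{B}_H)_{\omega,0}$ consists of those $f\in H(\mathbb{B}_H)$ with $\lim_{\|z\|\to1}\omega(z)|\mathcal{R}f(z)|=0$. Limits as $\|z\|\to1$ are uniform over all $z\in\mathbb{B}_H$ with $\|z\|\to 1$. *)

theory Defs
  imports "HOL-Analysis.Analysis"
begin

text \<open>
  Complex Hilbert spaces, as Banach spaces whose norm comes from a complex inner product
  (linear in the first argument, conjugate-linear in the second). Positive definiteness of
  the inner product is contained in the last axiom together with the norm axioms.
\<close>

class complex_hilbert_space = banach +
  fixes scaleC :: "complex \<Rightarrow> 'a \<Rightarrow> 'a"  (infixr "*\<^sub>C" 75)
    and cinner :: "'a \<Rightarrow> 'a \<Rightarrow> complex"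
  assumes scaleC_add_right: "c *\<^sub>C (x + y) = c *\<^sub>C x + c *\<^sub>C y"
    and scaleC_add_left: "(c + d) *\<^sub>C x = c *\<^sub>C x + d *\<^sub>C x"
    and scaleC_scaleC: "c *\<^sub>C (d *\<^sub>C x) = (c * d) *\<^sub>C x"
    and scaleC_one: "1 *\<^sub>C x = x"
    and scaleR_scaleC: "r *\<^sub>R x = complex_of_real r *\<^sub>C x"
    and cinner_commute: "cinner x y = cnj (cinner y x)"
    and cinner_add_left: "cinner (x + y) z = cinner x z + cinner y z"
    and cinner_scaleC_left: "cinner (c *\<^sub>C x) y = c * cinner x y"
    and cinner_norm: "cinner x x = complex_of_real ((norm x)\<^sup>2)"

instantiation complex :: complex_hilbert_space
begin

definition scaleC_complex :: "complex \<Rightarrow> complex \<Rightarrow> complex"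
  where "scaleC_complex c x = c * x"

definition cinner_complex :: "complex \<Rightarrow> complex \<Rightarrow> complex"
  where "cinner_complex x y = x * cnj y"

instance
proof
  fix x :: complex
  show "cinner x x = complex_of_real ((norm x)\<^sup>2)"
    unfolding cinner_complex_def by (rule complex_norm_square [symmetric])
qed (simp_all add: scaleC_complex_def cinner_complex_def algebra_simps scaleR_conv_of_real)

end

text \<open>Monotonicity is non-strict.\<close>

definition normal_weight :: "(real \<Rightarrow> real) \<Rightarrow> bool"
  where "normal_weight \<omega> \<longleftrightarrow>
    continuous_on {0..<1} \<omega> \<and> (\<forall>r\<in>{0..<1}. 0 < \<omega> r) \<and>
    (\<exists>\<delta> a b. 0 \<le> \<delta> \<and> \<delta> < 1 \<and> 0 < a \<and> a < b \<and>
      antimono_on {\<delta>..<1} (\<lambda>r. \<omega> r / (1 - r) powr a) \<and>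
      mono_on {\<delta>..<1} (\<lambda>r. \<omega> r / (1 - r) powr b))"

text \<open>
  Functions on the open unit ball are total functions whose values off the ball are ignored.
  Holomorphic means complex Frechet differentiable: \<open>has_derivative\<close> is the real Frechet
  derivative, so complex linearity of the derivative is required separately.
\<close>

definition hol_ball :: "('a::complex_hilbert_space \<Rightarrow> complex) set"
  where "hol_ball = {f. \<forall>z\<in>ball 0 1. \<exists>D.
    (f has_derivative D) (at z) \<and> (\<forall>c v. D (c *\<^sub>C v) = c * D v)}"

definition radial_deriv :: "('a::complex_hilbert_space \<Rightarrow> complex) \<Rightarrow> 'a \<Rightarrow> complex"
  where "radial_deriv f z = frechet_derivative f (at z) z"

definition deriv_norm :: "('a::complex_hilbert_space \<Rightarrow> complex) \<Rightarrow> 'a \<Rightarrow> real"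
  where "deriv_norm f z = onorm (frechet_derivative f (at z))"

definition bloch_R :: "(real \<Rightarrow> real) \<Rightarrow> ('a::complex_hilbert_space \<Rightarrow> complex) set"
  where "bloch_R \<omega> = {f \<in> hol_ball.
    bdd_above ((\<lambda>z. \<omega> (norm z) * norm (radial_deriv f z)) ` ball 0 1)}"

definition bloch_R_norm :: "(real \<Rightarrow> real) \<Rightarrow> ('a::complex_hilbert_space \<Rightarrow> complex) \<Rightarrow> real"
  where "bloch_R_norm \<omega> f =
    norm (f 0) + (SUP z\<in>ball 0 1. \<omega> (norm z) * norm (radial_deriv f z))"

text \<open>
  The filter of the limit as \<open>norm z\<close> tends to 1 from below, uniformly in \<open>z\<close>; see
  \<open>tendsto_to_sphere_iff\<close>.
\<close>

definition to_sphere :: "'a::complex_hilbert_space filter"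
  where "to_sphere = filtercomap norm (at_left 1)"

lemma tendsto_to_sphere_iff:
  fixes g :: "'a::complex_hilbert_space \<Rightarrow> real"
  shows "(g \<longlongrightarrow> l) to_sphere \<longleftrightarrow>
    (\<forall>\<epsilon>>0. \<exists>\<rho><1. \<forall>z\<in>ball 0 1. \<rho> < norm z \<longrightarrow> \<bar>g z - l\<bar> < \<epsilon>)"
proof -
  have "eventually P to_sphere \<longleftrightarrow> (\<exists>\<rho><1. \<forall>z\<in>ball 0 1. \<rho> < norm z \<longrightarrow> P z)"
    for P :: "'a \<Rightarrow> bool"
  proof
    assume "eventually P to_sphere"
    then obtain Q where "eventually Q (at_left (1::real))" and "\<And>z. Q (norm z) \<Longrightarrow> P z"
      unfolding to_sphere_def eventually_filtercomap by blast
    then show "\<exists>\<rho><1. \<forall>z\<in>ball 0 1. \<rho> < norm z \<longrightarrow> P z"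
      using eventually_at_left_field[of Q 1] by auto
  next
    assume "\<exists>\<rho><1. \<forall>z\<in>ball 0 1. \<rho> < norm z \<longrightarrow> P z"
    then obtain \<rho> where \<rho>: "\<rho> < 1" "\<And>z. norm z < 1 \<Longrightarrow> \<rho> < norm z \<Longrightarrow> P z"
      by auto
    have "eventually (\<lambda>r. \<rho> < r \<and> r < 1) (at_left (1::real))"
      unfolding eventually_at_left_field using \<rho>(1) by blast
    then show "eventually P to_sphere"
      unfolding to_sphere_def eventually_filtercomap using \<rho>(2) by blast
  qed
  then show ?thesis
    by (simp add: tendsto_iff dist_real_def)
qed

definition little_bloch_R :: "(real \<Rightarrow> real) \<Rightarrow> ('a::complex_hilbert_space \<Rightarrow> complex) set"
  where "little_bloch_R \<omega> = {f \<in> hol_ball.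
    ((\<lambda>z. \<omega> (norm z) * norm (radial_deriv f z)) \<longlongrightarrow> 0) to_sphere}"

end

theory Submission
  imports Defs "HOL-Complex_Analysis.Complex_Analysis"
begin

text \<open>
  For a unit vector \<open>u\<close> the derivative of \<open>f\<close> at \<open>t u\<close> in direction \<open>u\<close> is the radial derivative
  divided by \<open>t\<close>. For \<open>v\<close> orthogonal to \<open>u\<close>, Cauchy's inequality on tangential discs of radius
  comparable to \<open>sqrt (1 - t)\<close> bounds the change of \<open>t Df(t u) v\<close> between two radii whose
  distances to the sphere differ by a factor of at most 2 by \<open>sqrt (1 - t) / \<omega>(t)\<close> times a bound for
  \<open>\<omega> \<bar>R f\<bar>\<close>. As \<open>\<omega>\<close> is decreasing near 1, these changes sum up geometrically along dyadic radii to
  a multiple of \<open>1 / \<omega>(t)\<close>. Starting the summation at a radius beyond which \<open>\<omega> \<bar>R f\<bar>\<close> is small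
  gives the little-o statement, since \<open>\<omega>\<close> tends to 0. Inside a fixed smaller ball the maximum
  principle and Cauchy's inequality suffice.
\<close>

section \<open>Geometry of complex Hilbert spaces\<close>

lemma scaleC_zero_left: "0 *\<^sub>C (x::'a::complex_hilbert_space) = 0"
  using scaleR_scaleC[of 0 x] by simp

lemma norm_scaleC: "norm (c *\<^sub>C (x::'a::complex_hilbert_space)) = cmod c * norm x"
proof -
  have "cinner (c *\<^sub>C x) (c *\<^sub>C x) = c * cnj c * cinner x x"
    by (metis cinner_scaleC_left cinner_commute complex_cnj_mult mult.assoc mult.left_commute)
  then have "complex_of_real ((norm (c *\<^sub>C x))\<^sup>2) = complex_of_real ((cmod c * norm x)\<^sup>2)"
    by (simp only: cinner_norm complex_norm_square [symmetric] of_real_mult [symmetric] power_mult_distrib)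
  then have "(norm (c *\<^sub>C x))\<^sup>2 = (cmod c * norm x)\<^sup>2"
    by (simp only: of_real_eq_iff)
  then show ?thesis
    by (simp add: power2_eq_iff_nonneg)
qed

lemma norm_add_orthogonal:
  fixes x y :: "'a::complex_hilbert_space"
  assumes "cinner x y = 0"
  shows "(norm (x + y))\<^sup>2 = (norm x)\<^sup>2 + (norm y)\<^sup>2"
proof -
  have yx: "cinner y x = 0"
    using assms cinner_commute[of y x] by simp
  have r: "cinner w (x + y) = cinner w x + cinner w y" for w
    by (metis cinner_add_left cinner_commute complex_cnj_add)
  have "cinner (x + y) (x + y) = cinner x x + cinner y y"
    using assms yx by (simp add: cinner_add_left r)
  then have "complex_of_real ((norm (x + y))\<^sup>2) = complex_of_real ((norm x)\<^sup>2 + (norm y)\<^sup>2)"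
    by (simp only: cinner_norm of_real_add)
  then show ?thesis
    by (simp only: of_real_eq_iff)
qed

lemma cinner_scaleC_right: "cinner x (c *\<^sub>C y) = cnj c * cinner x (y::'a::complex_hilbert_space)"
  by (metis cinner_commute cinner_scaleC_left complex_cnj_mult)

lemma bounded_linear_scaleC_left: "bounded_linear (\<lambda>c. c *\<^sub>C (x::'a::complex_hilbert_space))"
proof (rule bounded_linear_intro[where K = "norm x"])
  show "(r *\<^sub>R c) *\<^sub>C x = r *\<^sub>R (c *\<^sub>C x)" for r c
    by (simp add: scaleR_scaleC[of r "c *\<^sub>C x"] scaleC_scaleC scaleR_conv_of_real)
qed (simp_all add: scaleC_add_left norm_scaleC)

text \<open>Projection onto the complex line through \<open>u\<close>; Pythagoras bounds both
  components by \<open>norm v\<close>. It splits a direction into a radial and a tangential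
  part.\<close>

lemma orthogonal_decomposition:
  fixes u v :: "'a::complex_hilbert_space"
  assumes "norm u = 1"
  obtains c v' where "v = c *\<^sub>C u + v'" "cinner u v' = 0" "cmod c \<le> norm v" "norm v' \<le> norm v"
proof -
  define c where "c = cinner v u"
  define v' where "v' = v - c *\<^sub>C u"
  have v: "v = c *\<^sub>C u + v'"
    by (simp add: v'_def)
  have "cinner v u = c * cinner u u + cinner v' u"
    by (subst v) (simp only: cinner_add_left cinner_scaleC_left)
  then have "cinner v' u = 0"
    using assms by (simp add: cinner_norm c_def)
  then have o: "cinner u v' = 0"
    using cinner_commute[of u v'] by simp
  then have "(norm v)\<^sup>2 = (norm (c *\<^sub>C u))\<^sup>2 + (norm v')\<^sup>2"
    unfolding v by (intro norm_add_orthogonal) (simp add: cinner_scaleC_left)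
  then have "(norm v)\<^sup>2 = (cmod c)\<^sup>2 + (norm v')\<^sup>2"
    using assms by (simp add: norm_scaleC)
  then have "(cmod c)\<^sup>2 \<le> (norm v)\<^sup>2" "(norm v')\<^sup>2 \<le> (norm v)\<^sup>2"
    using zero_le_power2[of "norm v'"] zero_le_power2[of "cmod c"] by linarith+
  then have "cmod c \<le> norm v" "norm v' \<le> norm v"
    by (simp_all add: power2_le_iff_abs_le)
  with v o show thesis
    by (rule that)
qed

section \<open>Complex slices and the norm of the derivative\<close>

text \<open>Uniqueness of the Frechet derivative identifies the witness in \<open>hol_ball\<close>
  with \<open>frechet_derivative\<close>, which thereby inherits complex homogeneity.\<close>

lemma hol_ball_has_derivative:
  assumes "f \<in> hol_ball" "norm z < 1"
  shows "(f has_derivative frechet_derivative f (at z)) (at z)"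
    and "frechet_derivative f (at z) (c *\<^sub>C v) = c * frechet_derivative f (at z) v"
proof -
  have "\<forall>z\<in>ball 0 1. \<exists>D. (f has_derivative D) (at z) \<and> (\<forall>c v. D (c *\<^sub>C v) = c * D v)"
    using assms(1) unfolding hol_ball_def by (rule CollectD)
  moreover have "z \<in> ball 0 1"
    using assms(2) by simp
  ultimately have "\<exists>D. (f has_derivative D) (at z) \<and> (\<forall>c v. D (c *\<^sub>C v) = c * D v)"
    by (rule bspec)
  then obtain D where D: "(f has_derivative D) (at z)" "\<forall>c v. D (c *\<^sub>C v) = c * D v"
    by (elim exE conjE)
  have "frechet_derivative f (at z) = D"
    using frechet_derivative_at[OF D(1)] by simp
  with D show "(f has_derivative frechet_derivative f (at z)) (at z)"
    "frechet_derivative f (at z) (c *\<^sub>C v) = c * frechet_derivative f (at z) v"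
    by simp_all
qed

text \<open>Chain rule along a complex line. Complex homogeneity turns the real derivative into
  multiplication by a complex number, so that one-variable function theory applies to the
  slices.\<close>

lemma hol_ball_slice:
  assumes "f \<in> hol_ball" "norm (x + l *\<^sub>C v) < 1"
  shows "((\<lambda>l. f (x + l *\<^sub>C v)) has_field_derivative
    frechet_derivative f (at (x + l *\<^sub>C v)) v) (at l)"
proof -
  have "((\<lambda>l. x + l *\<^sub>C v) has_derivative (\<lambda>l. l *\<^sub>C v)) (at l)"
    by (auto intro!: derivative_eq_intros bounded_linear_imp_has_derivative bounded_linear_scaleC_left)
  then have "((\<lambda>l. f (x + l *\<^sub>C v)) has_derivative
      (\<lambda>h. frechet_derivative f (at (x + l *\<^sub>C v)) (h *\<^sub>C v))) (at l)"
    using hol_ball_has_derivative(1)[OF assms] by (rule has_derivative_compose)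
  then show ?thesis
    using hol_ball_has_derivative(2)[OF assms]
    by (simp add: has_field_derivative_def mult.commute[of _ "frechet_derivative _ _ _"])
qed

lemma radial_deriv_scaleC:
  assumes "f \<in> hol_ball" "norm (c *\<^sub>C x) < 1"
  shows "radial_deriv f (c *\<^sub>C x) = c * frechet_derivative f (at (c *\<^sub>C x)) x"
  unfolding radial_deriv_def by (rule hol_ball_has_derivative(2)[OF assms])

lemma norm_frechet_derivative_le_deriv_norm:
  assumes "f \<in> hol_ball" "norm z < 1"
  shows "norm (frechet_derivative f (at z) v) \<le> deriv_norm f z * norm v"
  unfolding deriv_norm_def
  by (rule onorm[OF has_derivative_bounded_linear[OF hol_ball_has_derivative(1)[OF assms]]])

lemma deriv_norm_nonneg:
  assumes "f \<in> hol_ball" "norm z < 1"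
  shows "0 \<le> deriv_norm f z"
  unfolding deriv_norm_def
  by (rule onorm_pos_le[OF has_derivative_bounded_linear[OF hol_ball_has_derivative(1)[OF assms]]])

lemma deriv_norm_le:
  assumes f: "f \<in> hol_ball" "norm z < 1"
    and B: "\<And>v. norm v \<le> 1 \<Longrightarrow> norm (frechet_derivative f (at z) v) \<le> B"
  shows "deriv_norm f z \<le> B"
proof -
  interpret D: bounded_linear "frechet_derivative f (at z)"
    by (rule has_derivative_bounded_linear[OF hol_ball_has_derivative(1)[OF f]])
  have "norm (frechet_derivative f (at z) v) \<le> B * norm v" for v
  proof (cases "v = 0")
    case False
    have "norm (frechet_derivative f (at z) (v /\<^sub>R norm v)) \<le> B"
      using False by (intro B) simp
    then show ?thesis
      using False by (simp add: D.scaleR field_simps)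
  qed (simp add: D.zero)
  moreover have "0 \<le> B"
    using B[of 0] by (simp add: D.zero)
  ultimately show ?thesis
    unfolding deriv_norm_def by (intro onorm_bound) (auto simp: mult.commute)
qed

text \<open>The easy half of every equivalence: \<open>z\<close> itself is a direction of norm less
  than 1.\<close>

lemma radial_deriv_le_deriv_norm:
  assumes "f \<in> hol_ball" "norm z < 1"
  shows "norm (radial_deriv f z) \<le> deriv_norm f z"
proof -
  have "norm (radial_deriv f z) \<le> deriv_norm f z * norm z"
    unfolding radial_deriv_def by (rule norm_frechet_derivative_le_deriv_norm[OF assms])
  also have "\<dots> \<le> deriv_norm f z * 1"
    using assms deriv_norm_nonneg[OF assms] by (intro mult_left_mono) auto
  finally show ?thesis by simp
qed

section \<open>Estimates inside a smaller ball\<close>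

text \<open>
  On a slice, \<open>radial_deriv f (\<zeta> *\<^sub>C u) = \<zeta> * \<phi>' \<zeta>\<close> with \<open>\<phi> \<zeta> = f (\<zeta> *\<^sub>C u)\<close>; the maximum
  principle applied to \<open>\<phi>'\<close> absorbs the zero of the factor \<open>\<zeta>\<close> at the origin.
\<close>

lemma norm_diff_zero_le_radial_deriv:
  fixes f :: "'a::complex_hilbert_space \<Rightarrow> complex"
  assumes f: "f \<in> hol_ball" and R: "0 < R" "R < 1" and "0 \<le> G"
    and G: "\<And>w. norm w = R \<Longrightarrow> norm (radial_deriv f w) \<le> G"
    and w: "norm w \<le> R"
  shows "norm (f w - f 0) \<le> G"
proof (cases "w = 0")
  case True
  then show ?thesis
    using \<open>0 \<le> G\<close> by simp
next
  case False
  define u where "u = w /\<^sub>R norm w"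
  have u: "norm u = 1"
    using False by (simp add: u_def)
  \<comment> \<open>The summand \<open>0\<close> gives the slice the shape
    \<open>x + l *\<^sub>C v\<close> expected by \<open>hol_ball_slice\<close>.\<close>
  define \<phi> where "\<phi> = (\<lambda>l. f (0 + l *\<^sub>C u))"
  define \<phi>' where "\<phi>' = (\<lambda>l. frechet_derivative f (at (0 + l *\<^sub>C u)) u)"
  have d: "(\<phi> has_field_derivative \<phi>' l) (at l)" if "cmod l < 1" for l
    unfolding \<phi>_def \<phi>'_def by (rule hol_ball_slice[OF f]) (use that u in \<open>simp add: norm_scaleC\<close>)
  have "\<phi> holomorphic_on ball 0 1"
    using d unfolding holomorphic_on_open[OF open_ball] by fastforce
  then have "deriv \<phi> holomorphic_on ball 0 1"
    by (rule holomorphic_deriv) simp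
  moreover have "deriv \<phi> l = \<phi>' l" if "l \<in> ball 0 1" for l
    using d[of l] that by (simp add: DERIV_imp_deriv)
  ultimately have hol: "\<phi>' holomorphic_on ball 0 1"
    by (metis holomorphic_transform)
  have bd: "norm (\<phi>' l) \<le> G / R" if l: "l \<in> frontier (cball 0 R)" for l
  proof -
    have l: "cmod l = R"
      using l R by simp
    then have n: "norm (l *\<^sub>C u) = R"
      using u by (simp add: norm_scaleC)
    have "radial_deriv f (l *\<^sub>C u) = l * \<phi>' l"
      using radial_deriv_scaleC[OF f, of l u] n R by (simp add: \<phi>'_def)
    then have "R * norm (\<phi>' l) \<le> G"
      using G[OF n] l by (simp add: norm_mult)
    then show ?thesis
      using R by (simp add: field_simps)
  qed
  have bd': "norm (\<phi>' l) \<le> G / R" if "l \<in> cball 0 R" for l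
  proof (rule maximum_modulus_frontier[of \<phi>' "cball 0 R"])
    have "ball 0 R \<subseteq> ball (0::complex) 1" "cball 0 R \<subseteq> ball (0::complex) 1"
      using R by auto
    then show "\<phi>' holomorphic_on interior (cball 0 R)" "continuous_on (closure (cball 0 R)) \<phi>'"
      using hol holomorphic_on_subset holomorphic_on_imp_continuous_on by (auto simp: interior_cball)
  qed (use that bd in auto)
  \<comment> \<open>Mean value inequality in the convex disc \<open>cball 0 R\<close>; the two
    points are at most \<open>R\<close> apart, which cancels the denominator of
    \<open>G / R\<close>.\<close>
  have "norm (\<phi> (norm w) - \<phi> 0) \<le> G / R * norm (complex_of_real (norm w) - 0)"
    by (rule field_differentiable_bound[of "cball 0 R" \<phi> \<phi>'])
       (use R w bd' in \<open>auto intro!: has_field_derivative_at_within d\<close>)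
  also have "\<phi> (norm w) = f w"
    using False by (simp add: \<phi>_def u_def scaleR_scaleC [symmetric])
  also have "\<phi> 0 = f 0"
    by (simp add: \<phi>_def scaleC_zero_left)
  also have "G / R * norm (complex_of_real (norm w) - 0) \<le> G / R * R"
    using w bd'[of 0] R by (intro mult_left_mono) (auto intro: order_trans[OF norm_ge_zero])
  finally show ?thesis
    using R by simp
qed

text \<open>Cauchy's inequality for a function differentiable at every point of the closed disc, so
  that continuity up to the boundary is automatic.\<close>

lemma Cauchy_first_derivative_bound:
  fixes h :: "complex \<Rightarrow> complex"
  assumes "0 < r"
    and d: "\<And>l. cmod l \<le> r \<Longrightarrow> (h has_field_derivative h' l) (at l)"
    and B: "\<And>l. cmod l \<le> r \<Longrightarrow> norm (h l) \<le> B"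
  shows "norm (h' 0) \<le> B / r"
proof -
  have "norm ((deriv ^^ 1) h 0) \<le> fact 1 * B / r ^ 1"
  proof (rule Cauchy_inequality)
    show "h holomorphic_on ball 0 r"
      unfolding holomorphic_on_open[OF open_ball]
    proof
      show "\<exists>h'. (h has_field_derivative h') (at l)" if "l \<in> ball 0 r" for l
        using d[of l] that by auto
    qed
    show "continuous_on (cball 0 r) h"
      using d by (auto intro!: continuous_at_imp_continuous_on DERIV_isCont)
  qed (use assms in auto)
  moreover have "deriv h 0 = h' 0"
    using d[of 0] \<open>0 < r\<close> by (simp add: DERIV_imp_deriv)
  ultimately show ?thesis by simp
qed

text \<open>Discs of radius \<open>R - norm z\<close> around \<open>z\<close> stay in the closed
  ball of radius \<open>R\<close>, where \<open>f - f 0\<close> is bounded by \<open>G\<close>.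
  Subtracting \<open>f 0\<close> leaves the derivative unchanged and keeps the bound free of
  \<open>f 0\<close>.\<close>

lemma deriv_norm_le_sphere:
  fixes f :: "'a::complex_hilbert_space \<Rightarrow> complex"
  assumes f: "f \<in> hol_ball" and R: "R < 1" and "0 \<le> G"
    and G: "\<And>w. norm w = R \<Longrightarrow> norm (radial_deriv f w) \<le> G"
    and z: "norm z < R"
  shows "deriv_norm f z \<le> G / (R - norm z)"
proof (rule deriv_norm_le[OF f])
  fix v :: 'a
  assume v: "norm v \<le> 1"
  have n: "norm (z + l *\<^sub>C v) \<le> R" if "cmod l \<le> R - norm z" for l
  proof -
    have "norm (z + l *\<^sub>C v) \<le> norm z + cmod l * norm v"
      using norm_triangle_ineq[of z "l *\<^sub>C v"] by (simp add: norm_scaleC)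
    also have "cmod l * norm v \<le> cmod l"
      using v by (simp add: mult_left_le)
    finally show ?thesis using that by simp
  qed
  have R0: "0 < R"
    using z by (rule le_less_trans[OF norm_ge_zero])
  have "norm (frechet_derivative f (at (z + 0 *\<^sub>C v)) v) \<le> G / (R - norm z)"
  proof (rule Cauchy_first_derivative_bound)
    fix l assume l: "cmod l \<le> R - norm z"
    show "((\<lambda>l. f (z + l *\<^sub>C v) - f 0) has_field_derivative
        frechet_derivative f (at (z + l *\<^sub>C v)) v) (at l)"
      using DERIV_diff[OF hol_ball_slice[OF f, of z l v] DERIV_const[of "f 0"]] n[OF l] R by simp
    show "norm (f (z + l *\<^sub>C v) - f 0) \<le> G"
      by (rule norm_diff_zero_le_radial_deriv[OF f R0 R \<open>0 \<le> G\<close> G n[OF l]])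
  qed (use z in simp)
  then show "norm (frechet_derivative f (at z) v) \<le> G / (R - norm z)"
    by (simp add: scaleC_zero_left)
qed (use z R in simp)

section \<open>Tangential derivatives near the sphere\<close>

text \<open>
  For \<open>v\<close> orthogonal to \<open>u\<close> and \<open>\<bar>l\<bar>\<^sup>2 \<le> (1 - t) / 2\<close> the points \<open>\<tau> *\<^sub>C (u + l *\<^sub>C v)\<close> still have
  distance at least \<open>(1 - t) / 2\<close> from the sphere. Cauchy's inequality in \<open>l\<close> therefore only
  costs the square root of \<open>1 - t\<close>, and comparing \<open>f\<close> at two radii replaces the mixed second
  derivative of \<open>f\<close>.
\<close>

lemma tangential_derivative_step:
  fixes f :: "'a::complex_hilbert_space \<Rightarrow> complex"
  assumes f: "f \<in> hol_ball" and u: "norm u = 1" and uv: "cinner u v = 0" and v: "norm v \<le> 1"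
    and st: "1 / 2 \<le> s" "s \<le> t" "t < 1" "1 - s \<le> 2 * (1 - t)"
    and E: "\<And>w. s \<le> norm w \<Longrightarrow> norm w \<le> (1 + t) / 2 \<Longrightarrow> norm (radial_deriv f w) \<le> E"
  shows "norm (t * frechet_derivative f (at (t *\<^sub>R u)) v - s * frechet_derivative f (at (s *\<^sub>R u)) v)
    \<le> 2 * sqrt 2 * E * sqrt (1 - t)"
proof -
  define \<eta> where "\<eta> = sqrt ((1 - t) / 2)"
  have \<eta>: "0 < \<eta>" "\<eta>\<^sup>2 = (1 - t) / 2"
    using st by (simp_all add: \<eta>_def)
  have n: "s \<le> norm (complex_of_real \<tau> *\<^sub>C (u + l *\<^sub>C v))" (is "?A \<tau> l")
    "norm (complex_of_real \<tau> *\<^sub>C (u + l *\<^sub>C v)) \<le> (1 + t) / 2" (is "?B \<tau> l")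
    if "s \<le> \<tau>" "\<tau> \<le> t" "cmod l \<le> \<eta>" for \<tau> l
  proof -
    have "(norm (u + l *\<^sub>C v))\<^sup>2 = 1 + (cmod l * norm v)\<^sup>2"
      using norm_add_orthogonal[of u "l *\<^sub>C v"] u uv by (simp add: cinner_scaleC_right norm_scaleC)
    moreover have "(cmod l * norm v)\<^sup>2 \<le> (\<eta> * 1)\<^sup>2"
      using that v \<eta> by (intro power_mono mult_mono) auto
    ultimately have p: "1 \<le> (norm (u + l *\<^sub>C v))\<^sup>2" "(norm (u + l *\<^sub>C v))\<^sup>2 \<le> 1 + (1 - t) / 2"
      using \<eta> by simp_all
    have q: "(norm (complex_of_real \<tau> *\<^sub>C (u + l *\<^sub>C v)))\<^sup>2 = \<tau>\<^sup>2 * (norm (u + l *\<^sub>C v))\<^sup>2"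
      by (simp add: norm_scaleC power_mult_distrib)
    have "s\<^sup>2 * 1 \<le> \<tau>\<^sup>2 * (norm (u + l *\<^sub>C v))\<^sup>2"
      using p that st by (intro mult_mono power_mono) auto
    then show "?A \<tau> l"
      by (simp only: q [symmetric] mult_1_right) (rule power2_le_imp_le[OF _ norm_ge_zero])
    have "\<tau>\<^sup>2 * (norm (u + l *\<^sub>C v))\<^sup>2 \<le> t\<^sup>2 * (1 + (1 - t) / 2)"
      using p that st by (intro mult_mono power_mono) auto
    also have "\<dots> \<le> ((1 + t) / 2)\<^sup>2"
    proof -
      \<comment> \<open>Four times the difference of the two sides contains the factor
        \<open>1 - t\<close>; the other factor is visibly nonnegative.\<close>
      have "0 \<le> (1 - t) * (1 + t + 2 * (t * (1 - t)))"
        using st by (intro mult_nonneg_nonneg add_nonneg_nonneg) auto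
      also have "\<dots> = 4 * (((1 + t) / 2)\<^sup>2 - t\<^sup>2 * (1 + (1 - t) / 2))"
        by (simp add: power2_eq_square field_simps)
      finally show ?thesis
        by simp
    qed
    finally have "(norm (complex_of_real \<tau> *\<^sub>C (u + l *\<^sub>C v)))\<^sup>2 \<le> ((1 + t) / 2)\<^sup>2"
      by (simp only: q)
    then show "?B \<tau> l"
      by (rule power2_le_imp_le) (use st in simp)
  qed
  have s: "complex_of_real \<tau> *\<^sub>C u + l *\<^sub>C (complex_of_real \<tau> *\<^sub>C v)
      = complex_of_real \<tau> *\<^sub>C (u + l *\<^sub>C v)" for \<tau> l
    by (simp add: scaleC_add_right scaleC_scaleC mult.commute)
  have E0: "0 \<le> E"
  proof -
    have "norm (radial_deriv f (s *\<^sub>R u)) \<le> E"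
      using st u by (intro E) auto
    then show ?thesis
      using norm_ge_zero order_trans by blast
  qed
  \<comment> \<open>Scaling the direction \<open>v\<close> by \<open>\<tau>\<close> as well makes
    the points for fixed \<open>l\<close> and varying \<open>\<tau>\<close> lie on one ray. It also
    produces the factors \<open>t\<close> and \<open>s\<close> in the conclusion.\<close>
  define F where "F = (\<lambda>\<tau> l. f (complex_of_real \<tau> *\<^sub>C u + l *\<^sub>C (complex_of_real \<tau> *\<^sub>C v)))"
  define F' where "F' = (\<lambda>\<tau> l. frechet_derivative f
      (at (complex_of_real \<tau> *\<^sub>C u + l *\<^sub>C (complex_of_real \<tau> *\<^sub>C v))) (complex_of_real \<tau> *\<^sub>C v))"
  have d: "(F \<tau> has_field_derivative F' \<tau> l) (at l)" if "s \<le> \<tau>" "\<tau> \<le> t" "cmod l \<le> \<eta>" for \<tau> l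
    unfolding F_def F'_def
    by (rule hol_ball_slice[OF f]) (use n(2)[OF that] st in \<open>simp add: s\<close>)
  have "norm (F' t 0 - F' s 0) \<le> (2 * E * (1 - t)) / \<eta>"
  proof (rule Cauchy_first_derivative_bound)
    fix l assume l: "cmod l \<le> \<eta>"
    show "((\<lambda>l. F t l - F s l) has_field_derivative F' t l - F' s l) (at l)"
      using l st by (intro DERIV_diff d) auto
    define p where "p = u + l *\<^sub>C v"
    \<comment> \<open>For fixed \<open>l\<close>, \<open>f\<close> is compared along the ray through
      \<open>p\<close>. The derivative there is the radial derivative divided by
      \<open>\<tau>\<close>, at most \<open>2 * E\<close> because \<open>\<tau>\<close> is at least
      1/2, and \<open>t - s\<close> is at most \<open>1 - t\<close>.\<close>
    have "norm (f (0 + complex_of_real t *\<^sub>C p) - f (0 + complex_of_real s *\<^sub>C p))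
        \<le> 2 * E * norm (complex_of_real t - complex_of_real s)"
    proof (rule field_differentiable_bound)
      show "convex (closed_segment (complex_of_real s) (complex_of_real t))"
        by simp
      fix z assume "z \<in> closed_segment (complex_of_real s) (complex_of_real t)"
      then obtain \<tau> where \<tau>: "z = complex_of_real \<tau>" "s \<le> \<tau>" "\<tau> \<le> t"
        using st by (auto simp: closed_segment_of_real closed_segment_eq_real_ivl)
      note n' = n[OF \<tau>(2,3) l, folded p_def \<tau>(1)]
      have n1: "norm (z *\<^sub>C p) < 1"
        using n' st by simp
      show "((\<lambda>\<zeta>. f (0 + \<zeta> *\<^sub>C p)) has_field_derivative
          frechet_derivative f (at (0 + z *\<^sub>C p)) p)
          (at z within closed_segment (complex_of_real s) (complex_of_real t))"
        by (rule has_field_derivative_at_within, rule hol_ball_slice[OF f]) (use n1 in simp)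
      have "\<tau> * norm (frechet_derivative f (at (z *\<^sub>C p)) p) = norm (radial_deriv f (z *\<^sub>C p))"
        using radial_deriv_scaleC[OF f n1] \<tau> st by (simp add: norm_mult)
      also have "\<dots> \<le> E"
        by (rule E[OF n'])
      finally have "\<tau> * norm (frechet_derivative f (at (z *\<^sub>C p)) p) \<le> E" .
      moreover have "1 / 2 * norm (frechet_derivative f (at (z *\<^sub>C p)) p)
          \<le> \<tau> * norm (frechet_derivative f (at (z *\<^sub>C p)) p)"
        using \<tau> st by (intro mult_right_mono) auto
      ultimately show "norm (frechet_derivative f (at (0 + z *\<^sub>C p)) p) \<le> 2 * E"
        by simp
    qed auto
    also have "\<dots> = 2 * E * (t - s)"
      using st by (simp flip: of_real_diff)
    also have "\<dots> \<le> 2 * E * (1 - t)"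
      using st E0 by (intro mult_left_mono) auto
    finally show "norm (F t l - F s l) \<le> 2 * E * (1 - t)"
      by (simp add: F_def s p_def)
  qed (rule \<eta>)
  also have "(2 * E * (1 - t)) / \<eta> = 2 * sqrt 2 * E * sqrt (1 - t)"
    using st by (simp add: \<eta>_def real_sqrt_divide real_div_sqrt mult.assoc mult.left_commute divide_simps)
  finally show ?thesis
    using hol_ball_has_derivative(2)[OF f, of "s *\<^sub>R u" s v] hol_ball_has_derivative(2)[OF f, of "t *\<^sub>R u" t v] st u
    by (simp add: F'_def scaleC_zero_left scaleR_scaleC norm_scaleC)
qed

text \<open>Induction on the number \<open>n\<close> of doublings of the distance to the sphere that
  lead from \<open>t\<close> back to \<open>\<rho>\<close>. The claim carries
  \<open>2 - sqrt (1 - t)\<close> instead of the constant 2: the growth of this term from one dyadic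
  radius to the next absorbs the increment of the step.\<close>

lemma tangential_derivative_bound:
  fixes f :: "'a::complex_hilbert_space \<Rightarrow> complex" and \<omega> :: "real \<Rightarrow> real"
  assumes f: "f \<in> hol_ball" and u: "norm u = 1" and uv: "cinner u v = 0" and v: "norm v \<le> 1"
    and \<rho>: "1 / 2 \<le> \<rho>" "\<rho> < 1"
    and pos: "\<And>r. \<rho> \<le> r \<Longrightarrow> r < 1 \<Longrightarrow> 0 < \<omega> r"
    and anti: "\<And>r s. \<rho> \<le> r \<Longrightarrow> r \<le> s \<Longrightarrow> s < 1 \<Longrightarrow> \<omega> s \<le> \<omega> r"
    and c: "1 \<le> c" "\<And>r s. \<rho> \<le> r \<Longrightarrow> r \<le> s \<Longrightarrow> s < 1 \<Longrightarrow> 1 - r \<le> 2 * (1 - s) \<Longrightarrow> \<omega> r \<le> c * \<omega> s"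
    and e: "0 \<le> e" "\<And>w. \<rho> \<le> norm w \<Longrightarrow> norm w < 1 \<Longrightarrow> \<omega> (norm w) * norm (radial_deriv f w) \<le> e"
    and L: "\<rho> * norm (frechet_derivative f (at (\<rho> *\<^sub>R u)) v) \<le> L"
    and t: "\<rho> \<le> t" "t < 1" "1 - \<rho> \<le> 2 ^ n * (1 - t)"
  shows "t * norm (frechet_derivative f (at (t *\<^sub>R u)) v) \<le> L + 8 * c * e * (2 - sqrt (1 - t)) / \<omega> t"
  using t
proof (induction n arbitrary: t)
  case 0
  then have [simp]: "t = \<rho>" by simp
  have "sqrt (1 - \<rho>) \<le> 2"
    using \<rho> by (intro real_le_lsqrt) auto
  then have "0 \<le> 8 * c * e * (2 - sqrt (1 - t)) / \<omega> t"
    using c(1) e(1) pos[of \<rho>] \<rho> by (intro divide_nonneg_pos mult_nonneg_nonneg) auto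
  then show ?case
    using L by simp
next
  case (Suc n)
  define x where "x = sqrt (1 - t)"
  have x: "0 \<le> x" "x \<le> 1"
    using Suc.prems \<rho> by (auto simp: x_def)
  \<comment> \<open>The radius at twice the distance from the sphere, cut off at
    \<open>\<rho>\<close>.\<close>
  define s where "s = max \<rho> (1 - 2 * (1 - t))"
  have "1 * (1 - \<rho>) \<le> 2 ^ n * (1 - \<rho>)"
    using \<rho> by (intro mult_right_mono) auto
  then have s: "\<rho> \<le> s" "s \<le> t" "s < 1" "1 - s \<le> 2 * (1 - t)" "1 - \<rho> \<le> 2 ^ n * (1 - s)"
    using Suc.prems \<rho> by (auto simp: s_def max_def algebra_simps)
  have \<omega>t: "0 < \<omega> t"
    using Suc.prems pos by auto
  have "norm (t * frechet_derivative f (at (t *\<^sub>R u)) v - s * frechet_derivative f (at (s *\<^sub>R u)) v)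
      \<le> 2 * sqrt 2 * (c * e / \<omega> t) * sqrt (1 - t)"
  proof (rule tangential_derivative_step[OF f u uv v])
    fix w :: 'a assume w: "s \<le> norm w" "norm w \<le> (1 + t) / 2"
    then have w1: "norm w < 1" "\<rho> \<le> norm w" using Suc.prems s by auto
    \<comment> \<open>The points \<open>w\<close> may lie on either side of radius \<open>t\<close>:
      monotonicity covers the inner ones, and the doubling condition those up to
      \<open>(1 + t) / 2\<close>.\<close>
    have "\<omega> t \<le> c * \<omega> (norm w)"
    proof (cases "norm w \<le> t")
      case True
      then have "\<omega> t \<le> 1 * \<omega> (norm w)"
        using anti[of "norm w" t] Suc.prems w1 by simp
      also have "\<dots> \<le> c * \<omega> (norm w)"
        using c(1) pos w1 by (intro mult_right_mono) (auto simp: less_imp_le)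
      finally show ?thesis .
    next
      case False
      then show ?thesis
        using w w1 Suc.prems by (intro c(2)) (auto simp: field_simps)
    qed
    then have "\<omega> t * norm (radial_deriv f w) \<le> c * \<omega> (norm w) * norm (radial_deriv f w)"
      by (rule mult_right_mono) simp
    also have "\<dots> \<le> c * e"
      using e(2)[of w] w1 c(1) by (simp add: mult.assoc mult_left_mono)
    finally show "norm (radial_deriv f w) \<le> c * e / \<omega> t"
      using \<omega>t by (simp add: field_simps)
  qed (use s Suc.prems \<rho> in auto)
  then have 1: "norm (t * frechet_derivative f (at (t *\<^sub>R u)) v - s * frechet_derivative f (at (s *\<^sub>R u)) v)
      \<le> (c * e / \<omega> t) * (2 * sqrt 2 * x)"
    by (simp add: x_def mult_ac)
  \<comment> \<open>The subtracted \<open>2 * sqrt 2 * x\<close> is the room reserved for the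
    increment in \<open>1\<close>.\<close>
  have 2: "s * norm (frechet_derivative f (at (s *\<^sub>R u)) v)
      \<le> L + (c * e / \<omega> t) * (8 * (2 - x) - 2 * sqrt 2 * x)"
  proof (cases "s = \<rho>")
    case True
    have "sqrt 2 \<le> 2"
      by (intro real_le_lsqrt) auto
    then have "sqrt 2 * x \<le> 2 * 1"
      using x by (intro mult_mono) auto
    then have "0 \<le> (c * e / \<omega> t) * (8 * (2 - x) - 2 * sqrt 2 * x)"
      using c(1) e(1) \<omega>t x by (intro mult_nonneg_nonneg) auto
    then show ?thesis
      using True L by simp
  next
    case False
    then have "1 - s = 2 * (1 - t)"
      by (auto simp: s_def max_def split: if_splits)
    then have sx: "sqrt (1 - s) = sqrt 2 * x"
      by (simp only: x_def real_sqrt_mult)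
    have "sqrt (1 - s) \<le> 2"
      using s \<rho> by (intro real_le_lsqrt) auto
    then have "c * e * (8 * (2 - sqrt (1 - s))) / \<omega> s \<le> c * e * (8 * (2 - sqrt (1 - s))) / \<omega> t"
      using c(1) e(1) \<omega>t pos[of s] s anti[of s t] Suc.prems by (intro divide_left_mono mult_nonneg_nonneg) auto
    also have "\<dots> = (c * e / \<omega> t) * (8 * (2 - sqrt 2 * x))"
      by (simp add: sx)
    also have "\<dots> \<le> (c * e / \<omega> t) * (8 * (2 - x) - 2 * sqrt 2 * x)"
    proof (rule mult_left_mono)
      \<comment> \<open>The required inequality reduces to
        \<open>8 * x \<le> 6 * sqrt 2 * x\<close>; this is where the coefficient 8 of the claim is
        large enough.\<close>
      have "4 / 3 \<le> sqrt 2"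
        by (intro real_le_rsqrt) (simp add: power2_eq_square)
      then have "4 / 3 * x \<le> sqrt 2 * x"
        using x by (intro mult_right_mono) auto
      then show "8 * (2 - sqrt 2 * x) \<le> 8 * (2 - x) - 2 * sqrt 2 * x"
        by (simp add: algebra_simps)
    qed (use c(1) e(1) \<omega>t in auto)
    finally show ?thesis
      using Suc.IH[OF s(1,3,5)] by (simp add: mult_ac)
  qed
  have "t * norm (frechet_derivative f (at (t *\<^sub>R u)) v) = norm (t * frechet_derivative f (at (t *\<^sub>R u)) v)"
    using Suc.prems \<rho> by (simp add: norm_mult)
  also have "\<dots> \<le> norm (s * frechet_derivative f (at (s *\<^sub>R u)) v) +
      norm (t * frechet_derivative f (at (t *\<^sub>R u)) v - s * frechet_derivative f (at (s *\<^sub>R u)) v)"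
    by (rule norm_triangle_sub)
  also have "\<dots> \<le> L + (c * e / \<omega> t) * (8 * (2 - x) - 2 * sqrt 2 * x) + (c * e / \<omega> t) * (2 * sqrt 2 * x)"
    using 1 2 s \<rho> by (intro add_mono) (auto simp: norm_mult)
  also have "\<dots> = L + 8 * c * e * (2 - sqrt (1 - t)) / \<omega> t"
    using \<omega>t by (simp add: x_def field_simps)
  finally show ?case .
qed

text \<open>A direction at \<open>z\<close> is split into its radial and tangential parts; dividing
  by \<open>norm z\<close>, at least 1/2, costs a factor 2 in each. The bound \<open>L\<close> on
  the inner sphere enters only multiplied by \<open>\<omega> (norm z)\<close>, which is bounded for
  the first statement and tends to 0 for the second.\<close>

lemma deriv_norm_le_annulus:
  fixes f :: "'a::complex_hilbert_space \<Rightarrow> complex" and \<omega> :: "real \<Rightarrow> real"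
  assumes f: "f \<in> hol_ball"
    and \<rho>: "1 / 2 \<le> \<rho>" "\<rho> < 1"
    and pos: "\<And>r. \<rho> \<le> r \<Longrightarrow> r < 1 \<Longrightarrow> 0 < \<omega> r"
    and anti: "\<And>r s. \<rho> \<le> r \<Longrightarrow> r \<le> s \<Longrightarrow> s < 1 \<Longrightarrow> \<omega> s \<le> \<omega> r"
    and c: "1 \<le> c" "\<And>r s. \<rho> \<le> r \<Longrightarrow> r \<le> s \<Longrightarrow> s < 1 \<Longrightarrow> 1 - r \<le> 2 * (1 - s) \<Longrightarrow> \<omega> r \<le> c * \<omega> s"
    and e: "0 \<le> e" "\<And>w. \<rho> \<le> norm w \<Longrightarrow> norm w < 1 \<Longrightarrow> \<omega> (norm w) * norm (radial_deriv f w) \<le> e"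
    and L: "\<And>w. norm w = \<rho> \<Longrightarrow> deriv_norm f w \<le> L"
    and z: "\<rho> \<le> norm z" "norm z < 1"
  shows "\<omega> (norm z) * deriv_norm f z \<le> (2 + 32 * c) * e + 2 * L * \<omega> (norm z)"
proof -
  have zn: "z \<noteq> 0"
    using z \<rho> by auto
  define t where "t = norm z"
  define u where "u = z /\<^sub>R t"
  have t: "\<rho> \<le> t" "t < 1" "1 / 2 \<le> t" and u: "norm u = 1" and zu: "z = t *\<^sub>R u"
    using z \<rho> zn by (auto simp: t_def u_def)
  have \<omega>t: "0 < \<omega> t"
    using t pos by auto
  interpret D: bounded_linear "frechet_derivative f (at z)"
    by (rule has_derivative_bounded_linear[OF hol_ball_has_derivative(1)[OF f z(2)]])
  have half: "a \<le> 2 * b" if "t * a \<le> b" "0 \<le> a" for a b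
    using mult_right_mono[OF t(3) that(2)] that(1) by simp
  have radial: "norm (frechet_derivative f (at z) u) \<le> 2 * (e / \<omega> t)"
  proof (rule half)
    have "radial_deriv f z = t * frechet_derivative f (at z) u"
      unfolding radial_deriv_def using arg_cong[OF zu, of "frechet_derivative f (at z)"]
      by (simp only: D.scaleR scaleR_conv_of_real)
    then have "t * norm (frechet_derivative f (at z) u) = norm (radial_deriv f z)"
      using t by (simp add: norm_mult)
    also have "\<dots> \<le> e / \<omega> t"
      using e(2)[OF z] \<omega>t by (simp add: t_def field_simps)
    finally show "t * norm (frechet_derivative f (at z) u) \<le> e / \<omega> t" .
  qed simp
  have tangential: "norm (frechet_derivative f (at z) v) \<le> 2 * (L + 16 * c * e / \<omega> t)"
    if v: "cinner u v = 0" "norm v \<le> 1" for v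
  proof (rule half)
    obtain n where "(1 - \<rho>) / (1 - t) < 2 ^ n"
      using real_arch_pow[of 2 "(1 - \<rho>) / (1 - t)"] by auto
    then have n: "1 - \<rho> \<le> 2 ^ n * (1 - t)"
      using t by (simp add: field_simps)
    have "norm (frechet_derivative f (at (\<rho> *\<^sub>R u)) v) \<le> deriv_norm f (\<rho> *\<^sub>R u) * norm v"
      using u \<rho> by (intro norm_frechet_derivative_le_deriv_norm[OF f]) simp
    also have "\<dots> \<le> deriv_norm f (\<rho> *\<^sub>R u)"
      using v u \<rho> deriv_norm_nonneg[OF f, of "\<rho> *\<^sub>R u"] by (intro mult_left_le) auto
    also have "\<dots> \<le> L"
      using u \<rho> by (intro L) simp
    finally have "norm (frechet_derivative f (at (\<rho> *\<^sub>R u)) v) \<le> L" .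
    moreover have "\<rho> * norm (frechet_derivative f (at (\<rho> *\<^sub>R u)) v) \<le> norm (frechet_derivative f (at (\<rho> *\<^sub>R u)) v)"
      using \<rho> by (simp add: mult_left_le_one_le)
    ultimately have "\<rho> * norm (frechet_derivative f (at (\<rho> *\<^sub>R u)) v) \<le> L"
      by linarith
    from tangential_derivative_bound[OF f u v \<rho> pos anti c e this t(1,2) n]
    have "t * norm (frechet_derivative f (at z) v) \<le> L + 8 * c * e * (2 - sqrt (1 - t)) / \<omega> t"
      by (simp add: zu)
    also have "8 * c * e * (2 - sqrt (1 - t)) / \<omega> t \<le> 8 * c * e * 2 / \<omega> t"
      using c(1) e(1) \<omega>t t by (intro divide_right_mono mult_left_mono) auto
    finally show "t * norm (frechet_derivative f (at z) v) \<le> L + 16 * c * e / \<omega> t"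
      by simp
  qed simp
  have "deriv_norm f z \<le> 2 * (e / \<omega> t) + 2 * (L + 16 * c * e / \<omega> t)"
  proof (rule deriv_norm_le[OF f z(2)])
    fix v :: 'a assume v: "norm v \<le> 1"
    obtain k v' where d: "v = k *\<^sub>C u + v'" "cinner u v' = 0" "cmod k \<le> norm v" "norm v' \<le> norm v"
      using orthogonal_decomposition[OF u] .
    have "norm (frechet_derivative f (at z) v)
        = norm (k * frechet_derivative f (at z) u + frechet_derivative f (at z) v')"
      by (simp add: d(1) D.add hol_ball_has_derivative(2)[OF f z(2)])
    also have "\<dots> \<le> cmod k * norm (frechet_derivative f (at z) u) + norm (frechet_derivative f (at z) v')"
      by (rule order_trans[OF norm_triangle_ineq]) (simp add: norm_mult)
    also have "\<dots> \<le> 1 * (2 * (e / \<omega> t)) + 2 * (L + 16 * c * e / \<omega> t)"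
      using d v radial tangential[of v'] by (intro add_mono mult_mono) auto
    finally show "norm (frechet_derivative f (at z) v) \<le> 2 * (e / \<omega> t) + 2 * (L + 16 * c * e / \<omega> t)"
      by simp
  qed
  then have "\<omega> t * deriv_norm f z \<le> \<omega> t * (2 * (e / \<omega> t) + 2 * (L + 16 * c * e / \<omega> t))"
    using \<omega>t by (intro mult_left_mono) auto
  also have "\<dots> = (2 + 32 * c) * e + 2 * L * \<omega> t"
    using \<omega>t by (simp add: field_simps)
  finally show ?thesis
    by (simp add: t_def)
qed

section \<open>Consequences of normality of the weight\<close>

lemma normal_weight_pos:
  assumes "normal_weight \<omega>" "0 \<le> r" "r < 1"
  shows "0 < \<omega> r"
  using assms by (simp add: normal_weight_def)

text \<open>The quotient by the power \<open>a\<close> gives \<open>decay\<close>, from which both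
  monotonicity and the limit 0 follow since \<open>a\<close> is positive. The quotient by the power
  \<open>b\<close> gives the doubling condition with \<open>c = 2 powr b\<close>.\<close>

lemma normal_weight_obtains:
  assumes "normal_weight \<omega>"
  obtains \<rho> c where "1 / 2 \<le> \<rho>" "\<rho> < 1" "1 \<le> c"
    "\<And>r s. \<rho> \<le> r \<Longrightarrow> r \<le> s \<Longrightarrow> s < 1 \<Longrightarrow> \<omega> s \<le> \<omega> r"
    "\<And>r s. \<rho> \<le> r \<Longrightarrow> r \<le> s \<Longrightarrow> s < 1 \<Longrightarrow> 1 - r \<le> 2 * (1 - s) \<Longrightarrow> \<omega> r \<le> c * \<omega> s"
    "(\<omega> \<longlongrightarrow> 0) (at_left 1)"
proof -
  obtain \<delta> a b where d: "0 \<le> \<delta>" "\<delta> < 1" "0 < a" "a < b"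
    and a: "antimono_on {\<delta>..<1} (\<lambda>r. \<omega> r / (1 - r) powr a)"
    and b: "mono_on {\<delta>..<1} (\<lambda>r. \<omega> r / (1 - r) powr b)"
    using assms unfolding normal_weight_def by auto
  define \<rho> where "\<rho> = max \<delta> (1 / 2)"
  have \<rho>: "1 / 2 \<le> \<rho>" "\<rho> < 1" "\<delta> \<le> \<rho>"
    using d by (auto simp: \<rho>_def)
  have pos: "0 < \<omega> r" if "\<rho> \<le> r" "r < 1" for r
    using that \<rho> by (intro normal_weight_pos[OF assms]) auto
  have decay: "\<omega> s \<le> \<omega> r / (1 - r) powr a * (1 - s) powr a" if "\<rho> \<le> r" "r \<le> s" "s < 1" for r s
  proof -
    have "\<omega> s / (1 - s) powr a \<le> \<omega> r / (1 - r) powr a"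
      using a that \<rho> by (auto simp: monotone_on_def)
    then show ?thesis
      using that by (simp add: field_simps)
  qed
  have anti: "\<omega> s \<le> \<omega> r" if rs: "\<rho> \<le> r" "r \<le> s" "s < 1" for r s
  proof -
    have "(1 - s) powr a \<le> (1 - r) powr a"
      using rs d by (intro powr_mono2) auto
    then have "\<omega> r / (1 - r) powr a * (1 - s) powr a \<le> \<omega> r / (1 - r) powr a * (1 - r) powr a"
      using rs pos[of r] by (intro mult_left_mono) auto
    also have "\<dots> = \<omega> r"
      using rs by simp
    finally show ?thesis
      using decay[OF rs] by simp
  qed
  have double: "\<omega> r \<le> 2 powr b * \<omega> s"
    if rs: "\<rho> \<le> r" "r \<le> s" "s < 1" "1 - r \<le> 2 * (1 - s)" for r s
  proof -
    have "\<omega> r / (1 - r) powr b \<le> \<omega> s / (1 - s) powr b"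
      using b rs \<rho> by (auto simp: monotone_on_def)
    then have "\<omega> r \<le> \<omega> s / (1 - s) powr b * (1 - r) powr b"
      using rs by (simp add: field_simps)
    also have "\<dots> \<le> \<omega> s / (1 - s) powr b * (2 * (1 - s)) powr b"
      using rs d pos[of s] by (intro mult_left_mono powr_mono2) auto
    also have "\<dots> = 2 powr b * \<omega> s"
      using rs by (simp add: powr_mult del: right_diff_distrib_numeral left_diff_distrib_numeral)
    finally show ?thesis .
  qed
  have "(\<omega> \<longlongrightarrow> 0) (at_left 1)"
  proof (rule tendsto_sandwich)
    have ev: "eventually (\<lambda>r. \<rho> < r \<and> r < 1) (at_left (1::real))"
      using \<rho> unfolding eventually_at_left_field by blast
    show "eventually (\<lambda>r. 0 \<le> \<omega> r) (at_left 1)"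
      using ev by eventually_elim (auto intro: less_imp_le pos)
    show "eventually (\<lambda>r. \<omega> r \<le> \<omega> \<rho> / (1 - \<rho>) powr a * (1 - r) powr a) (at_left 1)"
      using ev by eventually_elim (intro decay, auto)
    have "((\<lambda>r. 1 - r :: real) \<longlongrightarrow> 1 - 1) (at_left 1)"
      by (intro tendsto_intros)
    moreover have "eventually (\<lambda>r. 0 \<le> 1 - r) (at_left (1::real))"
      using ev by eventually_elim auto
    ultimately have "((\<lambda>r. (1 - r) powr a) \<longlongrightarrow> 0) (at_left (1::real))"
      using tendsto_powr'[of "\<lambda>r. 1 - r" 0 "at_left 1" "\<lambda>_. a" a] d by simp
    then show "((\<lambda>r. \<omega> \<rho> / (1 - \<rho>) powr a * (1 - r) powr a) \<longlongrightarrow> 0) (at_left 1)"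
      by (rule tendsto_mult_right_zero)
  qed simp
  moreover have "1 \<le> 2 powr b"
    using d by (simp add: ge_one_powr_ge_zero)
  ultimately show thesis
    using that[OF \<rho>(1,2) _ anti double] by blast
qed

section \<open>Global bound and limit at the sphere\<close>

text \<open>The ball of radius \<open>\<rho>\<close> is handled by a slightly larger sphere, the
  rest by the annulus estimate. All constants are fixed before \<open>f\<close> and
  \<open>M\<close>, so \<open>C\<close> depends on \<open>\<omega>\<close> only.\<close>

lemma deriv_norm_le_radial_deriv:
  assumes \<omega>: "normal_weight \<omega>"
  obtains C where "0 < C"
    "\<And>(f :: 'a::complex_hilbert_space \<Rightarrow> complex) M z. f \<in> hol_ball \<Longrightarrow> 0 \<le> M \<Longrightarrow>
      (\<And>w. norm w < 1 \<Longrightarrow> \<omega> (norm w) * norm (radial_deriv f w) \<le> M) \<Longrightarrow> norm z < 1 \<Longrightarrow>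
      \<omega> (norm z) * deriv_norm f z \<le> C * M"
proof -
  obtain \<rho> c where \<rho>: "1 / 2 \<le> \<rho>" "\<rho> < 1" and c: "1 \<le> c"
    and anti: "\<And>r s. \<rho> \<le> r \<Longrightarrow> r \<le> s \<Longrightarrow> s < 1 \<Longrightarrow> \<omega> s \<le> \<omega> r"
    and double: "\<And>r s. \<rho> \<le> r \<Longrightarrow> r \<le> s \<Longrightarrow> s < 1 \<Longrightarrow> 1 - r \<le> 2 * (1 - s) \<Longrightarrow> \<omega> r \<le> c * \<omega> s"
    using normal_weight_obtains[OF \<omega>] by metis
  note pos = normal_weight_pos[OF \<omega>]
  have "continuous_on {0..\<rho>} \<omega>"
    using \<omega> \<rho> unfolding normal_weight_def by (auto elim!: continuous_on_subset)
  then have "bdd_above (\<omega> ` {0..\<rho>})"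
    by (intro bounded_imp_bdd_above compact_imp_bounded compact_continuous_image) auto
  then obtain W where W: "\<And>r. 0 \<le> r \<Longrightarrow> r \<le> \<rho> \<Longrightarrow> \<omega> r \<le> W"
    unfolding bdd_above_def by (metis atLeastAtMost_iff imageI)
  have W0: "0 < W"
    using W[of \<rho>] pos[of \<rho>] \<rho> by simp
  \<comment> \<open>Any radius strictly between \<open>\<rho>\<close> and 1 would do;
    \<open>k * M\<close> then bounds \<open>deriv_norm f\<close> on the closed ball of radius
    \<open>\<rho>\<close>.\<close>
  define R where "R = (1 + \<rho>) / 2"
  have R: "0 < R" "R < 1" "\<rho> < R"
    using \<rho> by (auto simp: R_def)
  define k where "k = 1 / (\<omega> R * (R - \<rho>))"
  have \<omega>R: "0 < \<omega> R"
    using pos R by simp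
  then have k: "0 < k"
    using R by (simp add: k_def)
  \<comment> \<open>The annulus estimate with \<open>L = k * M\<close> and \<open>\<omega>\<close>
    bounded by \<open>W\<close>; it also dominates the constant \<open>k * W\<close> of the inner
    ball.\<close>
  define C where "C = 2 + 32 * c + 2 * k * W"
  show thesis
  proof (rule that)
    show "0 < C"
      using c k W0 by (simp add: C_def add_pos_nonneg)
  next
    fix f :: "'a \<Rightarrow> complex" and M :: real and z :: 'a
    assume f: "f \<in> hol_ball" and M: "0 \<le> M"
      and g: "\<And>w. norm w < 1 \<Longrightarrow> \<omega> (norm w) * norm (radial_deriv f w) \<le> M"
      and z: "norm z < 1"
    have inner: "deriv_norm f w \<le> k * M" if w: "norm w \<le> \<rho>" for w
    proof -
      have "deriv_norm f w \<le> (M / \<omega> R) / (R - norm w)"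
      proof (rule deriv_norm_le_sphere[OF f R(2)])
        fix x :: 'a assume "norm x = R"
        then show "norm (radial_deriv f x) \<le> M / \<omega> R"
          using g[of x] R \<omega>R by (simp add: field_simps)
      qed (use M \<omega>R w R in auto)
      also have "\<dots> \<le> (M / \<omega> R) / (R - \<rho>)"
        using M \<omega>R w R by (intro divide_left_mono mult_pos_pos) auto
      finally show ?thesis
        by (simp add: k_def)
    qed
    show "\<omega> (norm z) * deriv_norm f z \<le> C * M"
    proof (cases "norm z \<le> \<rho>")
      case True
      have "\<omega> (norm z) * deriv_norm f z \<le> W * (k * M)"
        using W[of "norm z"] inner[of z] True W0 deriv_norm_nonneg[OF f z]
        by (intro mult_mono) auto
      also have "\<dots> \<le> C * M"
      proof -
        have "0 \<le> (2 + 32 * c + k * W) * M"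
          using c k W0 M by (intro mult_nonneg_nonneg) auto
        then show ?thesis
          by (simp add: C_def algebra_simps)
      qed
      finally show ?thesis .
    next
      case False
      then have "\<omega> (norm z) * deriv_norm f z \<le> (2 + 32 * c) * M + 2 * (k * M) * \<omega> (norm z)"
        using f \<rho> pos anti c double M g inner z by (intro deriv_norm_le_annulus[of f \<rho>]) auto
      also have "\<dots> \<le> (2 + 32 * c) * M + 2 * (k * M) * W"
        using W[of \<rho>] anti[of \<rho> "norm z"] False z \<rho> k M by (intro add_left_mono mult_left_mono) auto
      also have "\<dots> = C * M"
        by (simp add: C_def algebra_simps)
      finally show ?thesis .
    qed
  qed
qed

text \<open>The order of choices matters: \<open>e\<close> first makes one term of the annulus
  estimate equal to half of \<open>\<epsilon>\<close>, then \<open>\<rho>\<close> and with it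
  \<open>L\<close> are fixed, and only afterwards is \<open>\<omega>\<close> made small relative to
  \<open>L\<close>.\<close>

lemma tendsto_deriv_norm_if_radial_deriv:
  fixes f :: "'a::complex_hilbert_space \<Rightarrow> complex"
  assumes \<omega>: "normal_weight \<omega>" and f: "f \<in> hol_ball"
    and lim: "((\<lambda>z. \<omega> (norm z) * norm (radial_deriv f z)) \<longlongrightarrow> 0) to_sphere"
  shows "((\<lambda>z. \<omega> (norm z) * deriv_norm f z) \<longlongrightarrow> 0) to_sphere"
  unfolding tendsto_to_sphere_iff
proof (intro allI impI)
  fix \<epsilon> :: real assume "0 < \<epsilon>"
  obtain \<rho>0 c where \<rho>0: "1 / 2 \<le> \<rho>0" "\<rho>0 < 1" and c: "1 \<le> c"
    and anti: "\<And>r s. \<rho>0 \<le> r \<Longrightarrow> r \<le> s \<Longrightarrow> s < 1 \<Longrightarrow> \<omega> s \<le> \<omega> r"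
    and double: "\<And>r s. \<rho>0 \<le> r \<Longrightarrow> r \<le> s \<Longrightarrow> s < 1 \<Longrightarrow> 1 - r \<le> 2 * (1 - s) \<Longrightarrow> \<omega> r \<le> c * \<omega> s"
    and \<omega>lim: "(\<omega> \<longlongrightarrow> 0) (at_left 1)"
    using normal_weight_obtains[OF \<omega>] by metis
  note pos = normal_weight_pos[OF \<omega>]
  define e where "e = \<epsilon> / (2 * (2 + 32 * c))"
  have e: "0 < e" "(2 + 32 * c) * e = \<epsilon> / 2"
    using \<open>0 < \<epsilon>\<close> c by (auto simp: e_def divide_simps)
  obtain \<rho>1 where \<rho>1: "\<rho>1 < 1"
    "\<And>z::'a. norm z < 1 \<Longrightarrow> \<rho>1 < norm z \<Longrightarrow> \<bar>\<omega> (norm z) * norm (radial_deriv f z)\<bar> < e"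
    using lim e(1) unfolding tendsto_to_sphere_iff by auto
  \<comment> \<open>The midpoint lies strictly above \<open>\<rho>1\<close>, so the bound by
    \<open>e\<close> already holds on the sphere of radius \<open>\<rho>\<close>.\<close>
  define \<rho> where "\<rho> = (1 + max \<rho>0 \<rho>1) / 2"
  have \<rho>: "1 / 2 \<le> \<rho>" "\<rho> < 1" "\<rho>0 \<le> \<rho>" "\<rho>1 < \<rho>"
    using \<rho>0 \<rho>1 by (auto simp: \<rho>_def)
  have g: "\<omega> (norm w) * norm (radial_deriv f w) \<le> e" if "\<rho> \<le> norm w" "norm w < 1" for w :: 'a
    using \<rho>1(2)[of w] that \<rho> by auto
  define R where "R = (1 + \<rho>) / 2"
  have R: "R < 1" "\<rho> < R" "0 \<le> R"
    using \<rho> by (auto simp: R_def)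
  have \<omega>R: "0 < \<omega> R"
    using pos R by simp
  define L where "L = (e / \<omega> R) / (R - \<rho>)"
  have L0: "0 < L"
    using e \<omega>R R by (simp add: L_def)
  have L: "deriv_norm f w \<le> L" if w: "norm w = \<rho>" for w
    unfolding L_def w [symmetric]
  proof (rule deriv_norm_le_sphere[OF f R(1)])
    fix x :: 'a assume "norm x = R"
    then show "norm (radial_deriv f x) \<le> e / \<omega> R"
      using g[of x] R \<omega>R by (simp add: field_simps)
  qed (use e \<omega>R w R in auto)
  \<comment> \<open>This threshold keeps \<open>2 * L * \<omega> (norm z)\<close> below half of
    \<open>\<epsilon>\<close>.\<close>
  have "eventually (\<lambda>r. \<omega> r < \<epsilon> / (4 * L)) (at_left 1)"
    using order_tendstoD(2)[OF \<omega>lim, of "\<epsilon> / (4 * L)"] L0 \<open>0 < \<epsilon>\<close> by simp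
  then obtain \<rho>2 where \<rho>2: "\<rho>2 < 1" "\<And>r. \<rho>2 < r \<Longrightarrow> r < 1 \<Longrightarrow> \<omega> r < \<epsilon> / (4 * L)"
    unfolding eventually_at_left_field by blast
  show "\<exists>\<rho><1. \<forall>z\<in>ball 0 1. \<rho> < norm z \<longrightarrow> \<bar>\<omega> (norm z) * deriv_norm f z - 0\<bar> < \<epsilon>"
  proof (intro exI conjI ballI impI)
    show "max \<rho> \<rho>2 < 1"
      using \<rho> \<rho>2 by simp
    fix z :: 'a assume z: "z \<in> ball 0 1" "max \<rho> \<rho>2 < norm z"
    then have z': "norm z < 1" "\<rho> \<le> norm z" "\<rho>2 < norm z"
      by auto
    have "\<omega> (norm z) * deriv_norm f z \<le> (2 + 32 * c) * e + 2 * L * \<omega> (norm z)"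
      using f \<rho> pos anti c double e g L z' by (intro deriv_norm_le_annulus[of f \<rho>]) auto
    also have "\<dots> < \<epsilon> / 2 + \<epsilon> / 2"
      using \<rho>2(2)[OF z'(3,1)] L0 e(2) by (intro add_le_less_mono) (auto simp: field_simps)
    finally show "\<bar>\<omega> (norm z) * deriv_norm f z - 0\<bar> < \<epsilon>"
      using pos[of "norm z"] z' deriv_norm_nonneg[OF f z'(1)] by simp
  qed
qed

section \<open>The equivalences for both spaces\<close>

theorem theorem2p8:
  fixes \<omega> :: "real \<Rightarrow> real"
  assumes "normal_weight \<omega>"
  shows "(\<forall>f \<in> (hol_ball :: ('a::complex_hilbert_space \<Rightarrow> complex) set).
        f \<in> bloch_R \<omega> \<longleftrightarrow> bdd_above ((\<lambda>z. \<omega> (norm z) * deriv_norm f z) ` ball 0 1))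
    \<and> (\<exists>C>0. \<forall>f \<in> (bloch_R \<omega> :: ('a \<Rightarrow> complex) set).
        bloch_R_norm \<omega> f \<le> C * (norm (f 0) + (SUP z\<in>ball 0 1. \<omega> (norm z) * deriv_norm f z)) \<and>
        norm (f 0) + (SUP z\<in>ball 0 1. \<omega> (norm z) * deriv_norm f z) \<le> C * bloch_R_norm \<omega> f)
    \<and> (\<forall>f \<in> (hol_ball :: ('a \<Rightarrow> complex) set).
        f \<in> little_bloch_R \<omega> \<longleftrightarrow> ((\<lambda>z. \<omega> (norm z) * deriv_norm f z) \<longlongrightarrow> 0) to_sphere)"
proof -
  define g where "g f z = \<omega> (norm z) * norm (radial_deriv f z)" for f and z :: 'a
  define h where "h f z = \<omega> (norm z) * deriv_norm f z" for f and z :: 'a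
  obtain C where C: "0 < C"
    "\<And>f M z. f \<in> hol_ball \<Longrightarrow> 0 \<le> M \<Longrightarrow> (\<And>w. norm w < 1 \<Longrightarrow> g f w \<le> M) \<Longrightarrow> norm z < 1 \<Longrightarrow> h f z \<le> C * M"
    unfolding g_def h_def using deriv_norm_le_radial_deriv[OF assms] by metis
  have gh: "g f z \<le> h f z" and g0: "0 \<le> g f z" if "f \<in> hol_ball" "norm z < 1" for f z
    using radial_deriv_le_deriv_norm[OF that] normal_weight_pos[OF assms, of "norm z"] that
    by (auto simp: g_def h_def)
  have bloch: "f \<in> bloch_R \<omega> \<longleftrightarrow> f \<in> hol_ball \<and> bdd_above (g f ` ball 0 1)" for f
    by (simp add: bloch_R_def g_def [abs_def])
  \<comment> \<open>The supremum itself serves as the bound \<open>M\<close>; it is nonnegative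
    because it dominates \<open>g f 0\<close>.\<close>
  have hC: "h f z \<le> C * (SUP z\<in>ball 0 1. g f z)" if f: "f \<in> bloch_R \<omega>" and z: "norm z < 1" for f z
  proof -
    have f': "f \<in> hol_ball" "bdd_above (g f ` ball 0 1)"
      using f bloch by auto
    have le: "g f w \<le> (SUP z\<in>ball 0 1. g f z)" if "norm w < 1" for w
      using that f'(2) by (intro cSUP_upper) auto
    have "0 \<le> (SUP z\<in>ball 0 1. g f z)"
      using le[of 0] g0[OF f'(1), of 0] by simp
    then show ?thesis
      using le z by (intro C(2)[OF f'(1)]) auto
  qed
  have bdd: "f \<in> bloch_R \<omega> \<longleftrightarrow> bdd_above (h f ` ball 0 1)" if f: "f \<in> hol_ball" for f
  proof
    assume "f \<in> bloch_R \<omega>"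
    then show "bdd_above (h f ` ball 0 1)"
      using hC by (intro bdd_aboveI2[where M = "C * (SUP z\<in>ball 0 1. g f z)"]) auto
  next
    assume "bdd_above (h f ` ball 0 1)"
    then obtain M where "\<And>z. norm z < 1 \<Longrightarrow> h f z \<le> M"
      unfolding bdd_above_def by (metis imageI mem_ball_0)
    then have "bdd_above (g f ` ball 0 1)"
      using gh[OF f] by (intro bdd_aboveI2[where M = M]) (auto intro: order_trans)
    then show "f \<in> bloch_R \<omega>"
      using f bloch by auto
  qed
  \<comment> \<open>\<open>C\<close> alone might be below 1; the maximum also covers the term
    \<open>norm (f 0)\<close> and the inequality that follows from \<open>g \<le> h\<close>.\<close>
  have equiv: "bloch_R_norm \<omega> f \<le> max 1 C * (norm (f 0) + (SUP z\<in>ball 0 1. h f z)) \<and>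
      norm (f 0) + (SUP z\<in>ball 0 1. h f z) \<le> max 1 C * bloch_R_norm \<omega> f" if f: "f \<in> bloch_R \<omega>" for f
  proof -
    have f': "f \<in> hol_ball" "bdd_above (g f ` ball 0 1)" "bdd_above (h f ` ball 0 1)"
      using f bloch bdd by auto
    have norm_eq: "bloch_R_norm \<omega> f = norm (f 0) + (SUP z\<in>ball 0 1. g f z)"
      by (simp add: bloch_R_norm_def g_def)
    have 1: "(SUP z\<in>ball 0 1. g f z) \<le> (SUP z\<in>ball 0 1. h f z)"
      using f'(3) gh[OF f'(1)] by (intro cSUP_mono) (auto intro!: bexI)
    have 2: "(SUP z\<in>ball 0 1. h f z) \<le> C * (SUP z\<in>ball 0 1. g f z)"
      using hC[OF f] by (intro cSUP_least) auto
    have "g f 0 \<le> (SUP z\<in>ball 0 1. g f z)"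
      using f'(2) by (intro cSUP_upper) auto
    then have 0: "0 \<le> (SUP z\<in>ball 0 1. g f z)"
      using g0[OF f'(1), of 0] by simp
    have "1 * (norm (f 0) + (SUP z\<in>ball 0 1. h f z)) \<le> max 1 C * (norm (f 0) + (SUP z\<in>ball 0 1. h f z))"
      using 0 1 by (intro mult_right_mono) auto
    moreover have "norm (f 0) \<le> max 1 C * norm (f 0)"
      using mult_right_mono[of 1 "max 1 C" "norm (f 0)"] by simp
    moreover have "C * (SUP z\<in>ball 0 1. g f z) \<le> max 1 C * (SUP z\<in>ball 0 1. g f z)"
      using 0 by (intro mult_right_mono) auto
    ultimately show ?thesis
      using 1 2 unfolding norm_eq distrib_left by linarith
  qed
  have little: "f \<in> little_bloch_R \<omega> \<longleftrightarrow> (h f \<longlongrightarrow> 0) to_sphere" if f: "f \<in> hol_ball" for f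
  proof
    assume "f \<in> little_bloch_R \<omega>"
    then show "(h f \<longlongrightarrow> 0) to_sphere"
      using tendsto_deriv_norm_if_radial_deriv[OF assms f] by (simp add: little_bloch_R_def h_def [abs_def])
  next
    assume h: "(h f \<longlongrightarrow> 0) to_sphere"
    \<comment> \<open>The squeeze of \<open>g\<close> between 0 and \<open>h\<close> is known only
      in the ball, to which the epsilon form of the limit restricts \<open>z\<close>.\<close>
    have "(g f \<longlongrightarrow> 0) to_sphere"
      unfolding tendsto_to_sphere_iff
    proof (intro allI impI)
      fix \<epsilon> :: real assume "0 < \<epsilon>"
      then obtain \<rho> where \<rho>: "\<rho> < 1" "\<And>z. norm z < 1 \<Longrightarrow> \<rho> < norm z \<Longrightarrow> \<bar>h f z\<bar> < \<epsilon>"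
        using h unfolding tendsto_to_sphere_iff by auto
      have "\<bar>g f z - 0\<bar> < \<epsilon>" if "norm z < 1" "\<rho> < norm z" for z
        using \<rho>(2)[OF that] gh[OF f that(1)] g0[OF f that(1)] by simp
      then show "\<exists>\<rho><1. \<forall>z\<in>ball 0 1. \<rho> < norm z \<longrightarrow> \<bar>g f z - 0\<bar> < \<epsilon>"
        using \<rho>(1) by auto
    qed
    then show "f \<in> little_bloch_R \<omega>"
      using f by (simp add: little_bloch_R_def g_def [abs_def])
  qed
  show ?thesis
    by (intro conjI ballI exI[of _ "max 1 C"] bdd [unfolded h_def [abs_def]]
        equiv [THEN conjunct1, unfolded h_def] equiv [THEN conjunct2, unfolded h_def]
        little [unfolded h_def [abs_def]]) simp_all
qed

end
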